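(* Consider solving the linear system $\sum_{i=1}^b H_i\beta=\sum_{i=1}^bX_i^\top y_i$ with $H_i=X_i^\top X_i$, which corresponds to minimizing the quadratic loss $F(\beta)=\sum_{i=1}^b f_i(\beta)$, $f_i(\beta)=\frac12\|X_i\beta-y_i\|_2^2$. Let $G=\sum_{i=1}^b H_i^{-1}$ and let $\beta^*$ be the minimizer of $F$. There exists a data distribution with $b=2$ (a family of two-agent data sets $(X_1,y_1),(X_2,y_2)$ with varying $\sigma$) for which the condition number of the preconditioned system matrix $G\sum_{i=1}^bH_i$ increases with $$\sigma:=\sum_{i=1}^2\Big\|\nabla^2f_i(\beta^* )-\tfrac1b\nabla^2F(\beta^* )\Big\|,$$ and attains its minimum when $\sigma=0$. Moreover, as $\sigma$ increases, this condition number can become arbitrarily large.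
   Context: Agent $i$ holds $X_i\in\mathbb{R}^{s_i\times p}$, $y_i\in\mathbb{R}^{s_i}$, with $H_i=X_i^\top X_i$ the local Hessian (invertible). $G=\sum_{i=1}^bH_i^{-1}$ is the aggregated local preconditioner used by the distributed preconditioned conjugate gradient method (D-PCG). Here $\nabla^2 f_i(\beta^* )=H_i$ and $\nabla^2F(\beta^* )=\sum_iH_i$. $\|\cdot\|$ is a fixed matrix norm. *)

theory Defs
  imports "HOL-Analysis.Analysis"
begin

definition gradient :: "('a::real_inner \<Rightarrow> real) \<Rightarrow> 'a \<Rightarrow> 'a" where
  "gradient f x = (THE D. GDERIV f x :> D)"

definition hessian :: "(real^'p \<Rightarrow> real) \<Rightarrow> real^'p \<Rightarrow> real^'p^'p" where
  "hessian f x = jacobian (gradient f) (at x)"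

text \<open>Only the norm axioms on the space of matrices are required; submultiplicativity is not
  assumed, so operator norms, the Frobenius norm and entrywise norms are all covered.\<close>

definition is_matrix_norm :: "(real^'n^'m \<Rightarrow> real) \<Rightarrow> bool" where
  "is_matrix_norm N \<longleftrightarrow>
     (\<forall>A. 0 \<le> N A) \<and> (\<forall>A. N A = 0 \<longleftrightarrow> A = 0) \<and>
     (\<forall>c A. N (c *\<^sub>R A) = \<bar>c\<bar> * N A) \<and> (\<forall>A B. N (A + B) \<le> N A + N B)"

text \<open>The condition number with respect to the operator norm induced by the Euclidean norm,
  i.e. the ratio of the extreme singular values. It is meaningful for invertible matrices only.\<close>

definition cond_number :: "real^'n^'n \<Rightarrow> real" where
  "cond_number A = onorm ((*v) A) * onorm ((*v) (matrix_inv A))"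

definition local_loss :: "real^'p^'s \<Rightarrow> real^'s \<Rightarrow> real^'p \<Rightarrow> real" where
  "local_loss X y \<beta> = 1/2 * (norm (X *v \<beta> - y))\<^sup>2"

definition local_hessian :: "real^'p^'s \<Rightarrow> real^'p^'p" where
  "local_hessian X = transpose X ** X"

text \<open>From here on there are two agents, so \<open>b = 2\<close>. Their sample sizes
  \<open>CARD('s1)\<close> and \<open>CARD('s2)\<close> may differ.\<close>

definition total_loss ::
    "real^'p^'s1 \<Rightarrow> real^'s1 \<Rightarrow> real^'p^'s2 \<Rightarrow> real^'s2 \<Rightarrow> real^'p \<Rightarrow> real" where
  "total_loss X1 y1 X2 y2 \<beta> = local_loss X1 y1 \<beta> + local_loss X2 y2 \<beta>"

definition system_matrix :: "real^'p^'s1 \<Rightarrow> real^'p^'s2 \<Rightarrow> real^'p^'p" where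
  "system_matrix X1 X2 = local_hessian X1 + local_hessian X2"

definition system_rhs ::
    "real^'p^'s1 \<Rightarrow> real^'s1 \<Rightarrow> real^'p^'s2 \<Rightarrow> real^'s2 \<Rightarrow> real^'p" where
  "system_rhs X1 y1 X2 y2 = transpose X1 *v y1 + transpose X2 *v y2"

definition preconditioner :: "real^'p^'s1 \<Rightarrow> real^'p^'s2 \<Rightarrow> real^'p^'p" where
  "preconditioner X1 X2 = matrix_inv (local_hessian X1) + matrix_inv (local_hessian X2)"

definition precond_cond :: "real^'p^'s1 \<Rightarrow> real^'p^'s2 \<Rightarrow> real" where
  "precond_cond X1 X2 = cond_number (preconditioner X1 X2 ** system_matrix X1 X2)"

text \<open>The quantity \<open>\<sigma>\<close>, evaluated at the point \<open>\<beta>\<close> (to be instantiated with the minimizer).\<close>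

definition heterogeneity ::
    "(real^'p^'p \<Rightarrow> real) \<Rightarrow> real^'p^'s1 \<Rightarrow> real^'s1 \<Rightarrow> real^'p^'s2 \<Rightarrow> real^'s2 \<Rightarrow> real^'p \<Rightarrow> real" where
  "heterogeneity N X1 y1 X2 y2 \<beta> =
     N (hessian (local_loss X1 y1) \<beta> - (1/2) *\<^sub>R hessian (total_loss X1 y1 X2 y2) \<beta>) +
     N (hessian (local_loss X2 y2) \<beta> - (1/2) *\<^sub>R hessian (total_loss X1 y1 X2 y2) \<beta>)"

end

theory Submission
  imports Defs
begin

text \<open>The two Hessians are taken diagonal: \<open>H\<^sub>2\<close> is the identity and \<open>H\<^sub>1\<close> differs from it in a
  single diagonal entry \<open>1 + t\<close>. Then \<open>\<sigma> = \<parallel>H\<^sub>1 - H\<^sub>2\<parallel>\<close> is proportional to \<open>t\<close>, the preconditioned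
  matrix is diagonal with entries \<open>4\<close> and \<open>(2 + t)\<^sup>2 / (1 + t) \<ge> 4\<close>, and its condition number is
  the ratio of the two.\<close>

section \<open>Gradients and Hessians of the quadratic losses\<close>

lemma gradient_eqI:
  assumes "GDERIV f x :> D"
  shows "gradient f x = D"
  unfolding gradient_def
proof (rule the_equality[where P = "\<lambda>D. GDERIV f x :> D"])
  fix D' assume "GDERIV f x :> D'"
  then have "(\<lambda>h. h \<bullet> D') = (\<lambda>h. h \<bullet> D)"
    using assms unfolding gderiv_def by (rule has_derivative_unique)
  then show "D' = D"
    by (metis inner_eq_zero_iff inner_diff_right right_minus_eq)
qed fact

text \<open>Differentiating the affine gradient removes \<open>c\<close> and leaves the linear map
  of \<open>A\<close>. Local and total losses both have such gradients, so their Hessians are the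
  same at every point.\<close>

lemma hessian_affine_gradient:
  assumes "\<And>x. GDERIV f x :> A *v x - c"
  shows "hessian f x = A"
proof -
  have "gradient f = (\<lambda>x. A *v x - c)"
    using assms by (auto intro: gradient_eqI)
  moreover have "((\<lambda>x. A *v x - c) has_derivative (*v) A) (at x)"
    by (auto intro!: derivative_eq_intros bounded_linear.has_derivative[OF matrix_vector_mul_bounded_linear])
  ultimately show ?thesis
    unfolding hessian_def jacobian_def
    by (metis frechet_derivative_at matrix_of_matrix_vector_mul)
qed

text \<open>Moving \<open>X\<close> across the inner product as its transpose exposes the gradient
  of the local loss. This serves both the derivative and the exact expansion of the loss.\<close>

lemma inner_residual:
  "(X *v h) \<bullet> (X *v \<beta> - y) = h \<bullet> (local_hessian X *v \<beta> - transpose X *v y)"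
  by (simp add: local_hessian_def inner_commute[of h] inner_commute[of "X *v h"] inner_diff_left
      dot_lmul_matrix flip: matrix_vector_mul_assoc)

lemma GDERIV_local_loss:
  "GDERIV (local_loss X y) \<beta> :> local_hessian X *v \<beta> - transpose X *v y"
proof -
  have "((\<lambda>\<beta>. 1/2 * ((X *v \<beta> - y) \<bullet> (X *v \<beta> - y))) has_derivative
      (\<lambda>h. (X *v h) \<bullet> (X *v \<beta> - y))) (at \<beta>)"
    by (auto intro!: derivative_eq_intros bounded_linear.has_derivative[OF matrix_vector_mul_bounded_linear]
        simp: inner_commute algebra_simps)
  then show ?thesis
    by (simp add: gderiv_def local_loss_def[abs_def] power2_norm_eq_inner inner_residual)
qed

lemma GDERIV_total_loss:
  "GDERIV (total_loss X1 y1 X2 y2) \<beta> :> system_matrix X1 X2 *v \<beta> - system_rhs X1 y1 X2 y2"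
  using GDERIV_add[OF GDERIV_local_loss[of X1 y1 \<beta>] GDERIV_local_loss[of X2 y2 \<beta>]]
  by (simp add: total_loss_def[abs_def] system_matrix_def system_rhs_def
      matrix_vector_mult_add_rdistrib algebra_simps)

lemma hessian_local_loss: "hessian (local_loss X y) \<beta> = local_hessian X"
  using GDERIV_local_loss by (rule hessian_affine_gradient)

lemma hessian_total_loss: "hessian (total_loss X1 y1 X2 y2) \<beta> = system_matrix X1 X2"
  using GDERIV_total_loss by (rule hessian_affine_gradient)

section \<open>Minimizers of the total loss\<close>

text \<open>This is the second-order Taylor expansion, exact because the loss is quadratic. Its
  remainder is a square, so stationary points can be seen to be minimizers without any convexity
  theory.\<close>

lemma local_loss_add:
  fixes X :: "real^'p^'s"
  shows "local_loss X y (\<beta> + h) =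
    local_loss X y \<beta> + h \<bullet> (local_hessian X *v \<beta> - transpose X *v y) + 1/2 * (norm (X *v h))\<^sup>2"
proof -
  have "(norm (a + b))\<^sup>2 = (norm b)\<^sup>2 + (norm a)\<^sup>2 + 2 * (a \<bullet> b)" for a b :: "real^'s"
    by (simp add: power2_norm_eq_inner inner_add_left inner_add_right inner_commute)
  moreover have "X *v (\<beta> + h) - y = X *v h + (X *v \<beta> - y)"
    by (simp add: matrix_vector_right_distrib)
  ultimately show ?thesis
    by (simp only: local_loss_def inner_residual) simp
qed

lemma total_loss_add:
  "total_loss X1 y1 X2 y2 (\<beta> + h) =
    total_loss X1 y1 X2 y2 \<beta> + h \<bullet> (system_matrix X1 X2 *v \<beta> - system_rhs X1 y1 X2 y2)
    + 1/2 * ((norm (X1 *v h))\<^sup>2 + (norm (X2 *v h))\<^sup>2)"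
  by (simp add: total_loss_def local_loss_add system_matrix_def system_rhs_def
      matrix_vector_mult_add_rdistrib inner_add_right inner_diff_right field_simps)

lemma is_arg_min_total_loss_iff:
  "is_arg_min (total_loss X1 y1 X2 y2) (\<lambda>_. True) \<beta> \<longleftrightarrow>
    system_matrix X1 X2 *v \<beta> = system_rhs X1 y1 X2 y2"
proof
  let ?F = "total_loss X1 y1 X2 y2"
  let ?g = "system_matrix X1 X2 *v \<beta> - system_rhs X1 y1 X2 y2"
  assume "is_arg_min ?F (\<lambda>_. True) \<beta>"
  then have "\<forall>\<beta>'\<in>UNIV. ?F \<beta> \<le> ?F \<beta>'"
    by (simp add: is_arg_min_linorder)
  moreover have "(?F has_derivative (\<lambda>h. h \<bullet> ?g)) (at \<beta>)"
    using GDERIV_total_loss by (simp add: gderiv_def)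
  ultimately have "(\<lambda>h. h \<bullet> ?g) = (\<lambda>h. 0)"
    using differential_zero_maxmin[of \<beta> UNIV ?F "\<lambda>h. h \<bullet> ?g"] by auto
  \<comment> \<open>The vanishing derivative is evaluated in the direction \<open>?g\<close>
    itself.\<close>
  then have "?g \<bullet> ?g = 0"
    by (rule fun_cong)
  then show "system_matrix X1 X2 *v \<beta> = system_rhs X1 y1 X2 y2"
    by simp
next
  let ?F = "total_loss X1 y1 X2 y2"
  assume "system_matrix X1 X2 *v \<beta> = system_rhs X1 y1 X2 y2"
  \<comment> \<open>In the exact expansion the linear term vanishes and only squares remain.\<close>
  then have "?F \<beta> \<le> ?F (\<beta> + (\<beta>' - \<beta>))" for \<beta>'
    unfolding total_loss_add by simp
  then show "is_arg_min ?F (\<lambda>_. True) \<beta>"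
    by (simp add: is_arg_min_linorder)
qed

text \<open>With two agents, the deviations from the mean Hessian are plus and minus half the
  difference, so each contributes half of its norm.\<close>

lemma heterogeneity_eq:
  assumes "is_matrix_norm N"
  shows "heterogeneity N X1 y1 X2 y2 \<beta> = N (local_hessian X1 - local_hessian X2)"
proof -
  let ?D = "local_hessian X1 - local_hessian X2"
  have scale: "N (c *\<^sub>R A) = \<bar>c\<bar> * N A" for c A
    using assms by (simp add: is_matrix_norm_def)
  have "local_hessian X1 - (1/2) *\<^sub>R system_matrix X1 X2 = (1/2) *\<^sub>R ?D"
    "local_hessian X2 - (1/2) *\<^sub>R system_matrix X1 X2 = (-1/2) *\<^sub>R ?D"
    by (simp_all add: system_matrix_def vec_eq_iff field_simps)
  then show ?thesis
    by (simp only: heterogeneity_def hessian_local_loss hessian_total_loss scale)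
qed

section \<open>Diagonal matrices and their condition numbers\<close>

definition diag_mat :: "('n \<Rightarrow> 'a) \<Rightarrow> 'a::zero^'n^'n" where
  "diag_mat d = (\<chi> i j. if i = j then d i else 0)"

lemma diag_mat_mult_vec: "diag_mat d *v x = (\<chi> i. d i * x $ i)"
  for d :: "'n::finite \<Rightarrow> real"
  by (simp add: diag_mat_def matrix_vector_mult_def if_distrib if_distribR cong: if_cong)

lemma diag_mat_mult: "diag_mat d ** diag_mat e = diag_mat (\<lambda>i. d i * e i)"
  for d e :: "'n::finite \<Rightarrow> real"
  by (simp add: matrix_eq diag_mat_mult_vec mult.assoc flip: matrix_vector_mul_assoc)

lemma diag_mat_add: "diag_mat d + diag_mat e = diag_mat (\<lambda>i. d i + e i)"
  for d e :: "'n::finite \<Rightarrow> 'a::monoid_add"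
  by (simp add: diag_mat_def vec_eq_iff)

text \<open>\<open>matrix_inv\<close> chooses some two-sided inverse; associativity leaves only one
  candidate.\<close>

lemma matrix_inv_eqI:
  fixes A :: "'a::semiring_1^'n^'n"
  assumes "A ** B = mat 1" "B ** A = mat 1"
  shows "matrix_inv A = B"
proof -
  have "A ** matrix_inv A = mat 1 \<and> matrix_inv A ** A = mat 1"
    unfolding matrix_inv_def by (rule someI[of _ B]) (use assms in simp)
  then show ?thesis
    by (metis assms(2) matrix_mul_assoc matrix_mul_lid matrix_mul_rid)
qed

lemma diag_mat_inverse:
  fixes d :: "'n::finite \<Rightarrow> real"
  assumes "\<And>i. d i \<noteq> 0"
  shows "invertible (diag_mat d)" "matrix_inv (diag_mat d) = diag_mat (\<lambda>i. inverse (d i))"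
proof -
  have "diag_mat d ** diag_mat (\<lambda>i. inverse (d i)) = mat 1"
    "diag_mat (\<lambda>i. inverse (d i)) ** diag_mat d = mat 1"
    using assms by (simp_all add: diag_mat_mult) (simp_all add: diag_mat_def mat_def)
  then show "invertible (diag_mat d)" "matrix_inv (diag_mat d) = diag_mat (\<lambda>i. inverse (d i))"
    by (auto simp: invertible_def intro: matrix_inv_eqI)
qed

lemma onorm_diag_mat:
  fixes d :: "'n::finite \<Rightarrow> real"
  assumes "\<And>i. \<bar>d i\<bar> \<le> \<bar>d k\<bar>"
  shows "onorm ((*v) (diag_mat d)) = \<bar>d k\<bar>"
proof (rule antisym)
  show "onorm ((*v) (diag_mat d)) \<le> \<bar>d k\<bar>"
  proof (rule onorm_le)
    fix x :: "real^'n"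
    have "norm (diag_mat d *v x) \<le> norm (d k *\<^sub>R x)"
      by (rule norm_le_componentwise_cart)
        (simp add: diag_mat_mult_vec abs_mult assms mult_right_mono)
    then show "norm (diag_mat d *v x) \<le> \<bar>d k\<bar> * norm x"
      by simp
  qed
  \<comment> \<open>The unit vector along \<open>k\<close> is an eigenvector that attains the upper
    bound.\<close>
  have "diag_mat d *v axis k 1 = d k *\<^sub>R axis k 1"
    by (simp add: diag_mat_mult_vec vec_eq_iff axis_def)
  then show "\<bar>d k\<bar> \<le> onorm ((*v) (diag_mat d))"
    using onorm[OF matrix_vector_mul_bounded_linear, of "diag_mat d" "axis k 1"] by simp
qed

text \<open>The entry at \<open>k\<close> gives the norm of the matrix; inversion reverses the order
  of absolute values, so the entry at \<open>m\<close> gives the norm of the inverse.\<close>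

lemma cond_number_diag_mat:
  fixes d :: "'n::finite \<Rightarrow> real"
  assumes "\<And>i. \<bar>d i\<bar> \<le> \<bar>d k\<bar>" "\<And>i. \<bar>d m\<bar> \<le> \<bar>d i\<bar>" "d m \<noteq> 0"
  shows "cond_number (diag_mat d) = \<bar>d k\<bar> / \<bar>d m\<bar>"
proof -
  have pos: "\<And>i. \<bar>d i\<bar> > 0"
    using assms(2,3) by (metis abs_ge_zero abs_le_zero_iff linorder_not_le order_trans)
  then have nz: "\<And>i. d i \<noteq> 0"
    by auto
  have "onorm ((*v) (diag_mat (\<lambda>i. inverse (d i)))) = \<bar>inverse (d m)\<bar>"
    by (rule onorm_diag_mat) (use assms(2) pos in \<open>simp add: le_imp_inverse_le\<close>)
  then show ?thesis
    using assms(1) nz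
    by (simp add: cond_number_def diag_mat_inverse onorm_diag_mat[of d k] divide_inverse)
qed

section \<open>Realizing diagonal Hessians and computing the preconditioned condition number\<close>

text \<open>An injection \<open>f\<close> of columns into rows lets column \<open>j\<close> have its
  only possibly nonzero entry, \<open>sqrt (d j)\<close>, in row \<open>f j\<close>. Distinct
  columns then have disjoint supports and are orthogonal.\<close>

lemma local_hessian_surj_diag_mat:
  assumes "CARD('p::finite) \<le> CARD('s::finite)" "\<And>i. 0 \<le> d i"
  obtains X :: "real^'p^'s" where "local_hessian X = diag_mat d"
proof -
  obtain f :: "'p \<Rightarrow> 's" where "inj f"
    using card_le_inj[of "UNIV :: 'p set" "UNIV :: 's set"] assms(1) by auto
  let ?X = "(\<chi> i j. if i = f j then sqrt (d j) else 0) :: real^'p^'s"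
  have "(transpose ?X ** ?X) $ i $ j = diag_mat d $ i $ j" for i j
  proof -
    have "(transpose ?X ** ?X) $ i $ j =
        (\<Sum>k\<in>UNIV. (if k = f i then sqrt (d i) else 0) * (if k = f j then sqrt (d j) else 0))"
      by (simp add: matrix_matrix_mult_def transpose_def)
    \<comment> \<open>Nesting the conditionals lets the sum collapse to its term at
      \<open>k = f i\<close>.\<close>
    also have "\<dots> =
        (\<Sum>k\<in>UNIV. if k = f i then sqrt (d i) * (if k = f j then sqrt (d j) else 0) else 0)"
      by (rule sum.cong) simp_all
    also have "\<dots> = sqrt (d i) * (if f i = f j then sqrt (d j) else 0)"
      by simp
    finally show ?thesis
      using \<open>inj f\<close> assms(2) by (auto simp: diag_mat_def inj_eq)
  qed
  then have "local_hessian ?X = diag_mat d"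
    by (simp add: local_hessian_def vec_eq_iff)
  then show thesis ..
qed

text \<open>The right-hand side shows the lower bound 4 and writes the excess as a product of two
  nonnegative factors increasing in \<open>t\<close>.\<close>

lemma precond_ratio_eq:
  fixes t :: real
  assumes "0 \<le> t"
  shows "(2 + t)\<^sup>2 / (1 + t) = 4 + t * (t / (1 + t))"
  using assms by (simp add: field_simps power2_eq_square)

lemma precond_cond_diag:
  fixes k :: "'p::finite"
  assumes card: "2 \<le> CARD('p)" and t: "0 \<le> t"
    and H1: "local_hessian X1 = diag_mat (\<lambda>i::'p. if i = k then 1 + t else 1)"
    and H2: "local_hessian X2 = diag_mat (\<lambda>i. 1)"
  shows "precond_cond X1 X2 = (4 + t * (t / (1 + t))) / 4"
proof -
  let ?d = "\<lambda>i. if i = k then (2 + t)\<^sup>2 / (1 + t) else 4"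
  \<comment> \<open>A second index supplies the smaller entry 4; in dimension one the condition
    number would be constantly 1.\<close>
  have "\<exists>m. m \<noteq> k"
  proof (rule ccontr)
    assume "\<nexists>m. m \<noteq> k"
    then have "UNIV = {k}" by auto
    then have "CARD('p) = card {k}" by (rule arg_cong)
    then show False using card by simp
  qed
  then obtain m where "m \<noteq> k" ..
  have "preconditioner X1 X2 ** system_matrix X1 X2 = diag_mat
      (\<lambda>i. (inverse (if i = k then 1 + t else 1) + 1) * ((if i = k then 1 + t else 1) + 1))"
    using t by (simp add: preconditioner_def system_matrix_def H1 H2 diag_mat_inverse diag_mat_add
        diag_mat_mult)
  also have "\<dots> = diag_mat ?d"
    using t by (intro arg_cong[of _ _ diag_mat] ext) (simp add: field_simps power2_eq_square)
  finally have "precond_cond X1 X2 = cond_number (diag_mat ?d)"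
    by (simp add: precond_cond_def)
  moreover have "(2 + t)\<^sup>2 / (1 + t) \<ge> 4"
    using t by (simp add: precond_ratio_eq)
  then have "cond_number (diag_mat ?d) = \<bar>?d k\<bar> / \<bar>?d m\<bar>"
    using \<open>m \<noteq> k\<close> t by (intro cond_number_diag_mat) auto
  ultimately show ?thesis
    using \<open>m \<noteq> k\<close> t by (simp add: precond_ratio_eq)
qed


section \<open>The family of data sets indexed by its heterogeneity\<close>

theorem proposition3p2:
  fixes N :: "real^'p^'p \<Rightarrow> real"
  assumes "is_matrix_norm N"
    and "2 \<le> CARD('p::finite)"
    and "CARD('p) \<le> CARD('s1::finite)"
    and "CARD('p) \<le> CARD('s2::finite)"
  shows "\<exists>(X1 :: real \<Rightarrow> real^'p^'s1) (y1 :: real \<Rightarrow> real^'s1)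
          (X2 :: real \<Rightarrow> real^'p^'s2) (y2 :: real \<Rightarrow> real^'s2) (\<beta>s :: real \<Rightarrow> real^'p).
    (\<forall>\<sigma>\<ge>0.
       invertible (local_hessian (X1 \<sigma>)) \<and> invertible (local_hessian (X2 \<sigma>)) \<and>
       (\<forall>\<beta>. is_arg_min (total_loss (X1 \<sigma>) (y1 \<sigma>) (X2 \<sigma>) (y2 \<sigma>)) (\<lambda>_. True) \<beta> \<longleftrightarrow>
            system_matrix (X1 \<sigma>) (X2 \<sigma>) *v \<beta> = system_rhs (X1 \<sigma>) (y1 \<sigma>) (X2 \<sigma>) (y2 \<sigma>)) \<and>
       (\<forall>\<beta>. is_arg_min (total_loss (X1 \<sigma>) (y1 \<sigma>) (X2 \<sigma>) (y2 \<sigma>)) (\<lambda>_. True) \<beta> \<longleftrightarrow>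
            \<beta> = \<beta>s \<sigma>) \<and>
       heterogeneity N (X1 \<sigma>) (y1 \<sigma>) (X2 \<sigma>) (y2 \<sigma>) (\<beta>s \<sigma>) = \<sigma>) \<and>
    strict_mono_on {0..} (\<lambda>\<sigma>. precond_cond (X1 \<sigma>) (X2 \<sigma>)) \<and>
    is_arg_min (\<lambda>\<sigma>. precond_cond (X1 \<sigma>) (X2 \<sigma>)) (\<lambda>\<sigma>. 0 \<le> \<sigma>) 0 \<and>
    filterlim (\<lambda>\<sigma>. precond_cond (X1 \<sigma>) (X2 \<sigma>)) at_top at_top"
proof -
  obtain k :: 'p where True by simp
  let ?E = "diag_mat (\<lambda>i. if i = k then 1 else 0) :: real^'p^'p"
  have "?E \<noteq> 0"
    by (auto simp: diag_mat_def vec_eq_iff)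
  define c where "c = N ?E"
  have norm_scale: "N (a *\<^sub>R A) = \<bar>a\<bar> * N A" for a A
    using assms(1) by (simp add: is_matrix_norm_def)
  have "c > 0"
    using assms(1) \<open>?E \<noteq> 0\<close> unfolding c_def is_matrix_norm_def by (metis less_eq_real_def)
  \<comment> \<open>The perturbation is \<open>t \<sigma> *\<^sub>R ?E\<close>, and dividing by
    \<open>c = N ?E\<close> makes its norm exactly \<open>\<sigma>\<close> for
    \<open>\<sigma> \<ge> 0\<close>, whatever the matrix norm.\<close>
  define t where "t \<sigma> = \<sigma> / c" for \<sigma>
  have t0: "0 \<le> t \<sigma>" if "0 \<le> \<sigma>" for \<sigma>
    using that \<open>c > 0\<close> by (simp add: t_def)
  define d where "d \<sigma> i = (if i = k then 1 + t \<sigma> else 1)" for \<sigma> i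
  \<comment> \<open>The guard makes existence hold for every real \<open>\<sigma>\<close>, so that
    choice yields a total function \<open>X1\<close>; for negative \<open>\<sigma>\<close> the
    matrix need not be a Gram matrix.\<close>
  have "\<exists>X :: real^'p^'s1. 0 \<le> \<sigma> \<longrightarrow> local_hessian X = diag_mat (d \<sigma>)" for \<sigma>
  proof (cases "0 \<le> \<sigma>")
    case True
    then have "\<And>i. 0 \<le> d \<sigma> i"
      using t0 by (simp add: d_def)
    then obtain X :: "real^'p^'s1" where "local_hessian X = diag_mat (d \<sigma>)"
      using local_hessian_surj_diag_mat[OF assms(3)] by metis
    then show ?thesis by blast
  qed simp
  then obtain X1 :: "real \<Rightarrow> real^'p^'s1"
    where H1: "\<And>\<sigma>. 0 \<le> \<sigma> \<Longrightarrow> local_hessian (X1 \<sigma>) = diag_mat (d \<sigma>)"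
    by metis
  obtain X2 :: "real^'p^'s2" where H2: "local_hessian X2 = diag_mat (\<lambda>i. 1)"
    using local_hessian_surj_diag_mat[OF assms(4)] zero_le_one by metis
  have cond: "precond_cond (X1 \<sigma>) X2 = (4 + t \<sigma> * (t \<sigma> / (1 + t \<sigma>))) / 4" if "0 \<le> \<sigma>" for \<sigma>
    using assms(2) t0[OF that] H1[OF that, unfolded d_def] H2 by (rule precond_cond_diag)
  have mono: "strict_mono_on {0..} (\<lambda>\<sigma>. precond_cond (X1 \<sigma>) X2)"
  proof (rule strict_mono_onI)
    fix r s :: real assume rs: "r \<in> {0..}" "s \<in> {0..}" "r < s"
    then have "0 \<le> t r" "t r < t s"
      using t0 \<open>c > 0\<close> by (auto simp: t_def divide_strict_right_mono)
    \<comment> \<open>Both factors are nonnegative and strictly increasing, since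
      \<open>t / (1 + t) = 1 - 1 / (1 + t)\<close>.\<close>
    then have "t r * (t r / (1 + t r)) < t s * (t s / (1 + t s))"
      by (intro mult_strict_mono') (auto simp: field_simps)
    then show "precond_cond (X1 r) X2 < precond_cond (X1 s) X2"
      using rs by (simp only: cond atLeast_iff divide_strict_right_mono)
  qed
  have lim: "filterlim (\<lambda>\<sigma>. precond_cond (X1 \<sigma>) X2) at_top at_top"
  proof (rule filterlim_at_top_mono)
    have "filterlim (\<lambda>\<sigma>. inverse (4 * c) * \<sigma>) at_top at_top"
      using \<open>c > 0\<close> by (intro filterlim_tendsto_pos_mult_at_top[OF tendsto_const] filterlim_ident) auto
    moreover have "(\<lambda>\<sigma>. t \<sigma> / 4) = (\<lambda>\<sigma>. inverse (4 * c) * \<sigma>)"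
      using \<open>c > 0\<close> by (simp add: t_def fun_eq_iff field_simps)
    ultimately show "filterlim (\<lambda>\<sigma>. t \<sigma> / 4) at_top at_top"
      by (simp only:)
    show "\<forall>\<^sub>F \<sigma> in at_top. t \<sigma> / 4 \<le> precond_cond (X1 \<sigma>) X2"
      using eventually_ge_at_top[of 0]
    proof eventually_elim
      case (elim \<sigma>)
      \<comment> \<open>The right side exceeds the left by
        \<open>4 - t \<sigma> / (1 + t \<sigma>)\<close>, which is more than 3.\<close>
      have "t \<sigma> \<le> 4 + t \<sigma> * (t \<sigma> / (1 + t \<sigma>))"
        using t0[OF elim] by (simp add: field_simps)
      then show ?case
        using elim by (simp add: cond)
    qed
  qed
  \<comment> \<open>Both response vectors will be zero, so this homogeneous system characterizes the
    minimizer, which is therefore 0 and unique.\<close>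
  have sys: "system_matrix (X1 \<sigma>) X2 *v \<beta> = 0 \<longleftrightarrow> \<beta> = 0" if "0 \<le> \<sigma>" for \<sigma> \<beta>
  proof -
    have "d \<sigma> i + 1 \<noteq> 0" for i
      using t0[OF that] by (simp add: d_def)
    then show ?thesis
      using that by (simp add: system_matrix_def H1 H2 diag_mat_add diag_mat_mult_vec vec_eq_iff)
  qed
  have "heterogeneity N (X1 \<sigma>) 0 X2 0 0 = \<sigma>" if "0 \<le> \<sigma>" for \<sigma>
  proof -
    have "local_hessian (X1 \<sigma>) - local_hessian X2 = t \<sigma> *\<^sub>R ?E"
      using that by (simp add: H1 H2 d_def diag_mat_def vec_eq_iff)
    then have "heterogeneity N (X1 \<sigma>) 0 X2 0 0 = t \<sigma> * c"
      using t0[OF that] by (simp add: heterogeneity_eq[OF assms(1)] norm_scale c_def)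
    then show ?thesis
      using \<open>c > 0\<close> by (simp add: t_def)
  qed
  moreover have "invertible (local_hessian (X1 \<sigma>))" if "0 \<le> \<sigma>" for \<sigma>
  proof -
    have "d \<sigma> i \<noteq> 0" for i
      using t0[OF that] by (simp add: d_def)
    then show ?thesis
      using that by (simp add: H1 diag_mat_inverse)
  qed
  moreover have "invertible (local_hessian X2)"
    by (simp add: H2 diag_mat_inverse)
  moreover have "is_arg_min (\<lambda>\<sigma>. precond_cond (X1 \<sigma>) X2) (\<lambda>\<sigma>. 0 \<le> \<sigma>) 0"
    using strict_mono_on_leD[OF mono, of 0] by (simp add: is_arg_min_linorder)
  ultimately show ?thesis
    using sys mono lim
    by (intro exI[of _ X1] exI[of _ "\<lambda>_. 0"] exI[of _ "\<lambda>_. X2"])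
      (simp add: is_arg_min_total_loss_iff system_rhs_def)
qed

end
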